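(* For every sequent $\Gamma$, the following three conditions are equivalent: (1) $\mathsf{GL_{Seq}} \vdash \Gamma$; (2) $\mathsf{GL_{\infty}} \vdash \Gamma$; (3) $\mathsf{GL_{circ}} \vdash \Gamma$.
   Context: Formulas are built by $A ::= P \mid \overline{P} \mid \top \mid \bot \mid (A \wedge A) \mid (A \vee A) \mid \Box A \mid \Diamond A$, where $P$ ranges over atoms and $\overline{P}$ is the (primitive) complement of $P$. The negation $\overline{A}$ of a formula is defined inductively: $\overline{(P)} := \overline{P}$, $\overline{\overline{P}} := P$, $\overline{\top} := \bot$, $\overline{\bot} := \top$, $\overline{(A \wedge B)} := (\overline{A} \vee \overline{B})$, $\overline{(A \vee B)} := (\overline{A} \wedge \overline{B})$, $\overline{\Box A} := \Diamond \overline{A}$, $\overline{\Diamond A} := \Box \overline{A}$. A sequent is a finite multiset of formulas; a comma denotes multiset union; for $\Gamma = A_1,\ldots,A_n$, $\Diamond\Gamma := \Diamond A_1,\ldots,\Diamond A_n$. The sequent calculus $\mathsf{GL_{Seq}}$ has initial sequents $\Gamma, A, \overline{A}$ ($A$ an arbitrary formula) and $\Gamma, \top$, and the inference rules: - ($\wedge$) from $\Gamma, A$ and $\Gamma, B$ infer $\Gamma, A\wedge B$; - ($\vee$) from $\Gamma, A, B$ infer $\Gamma, A\vee B$; - ($\Box_{\mathsf{GL}}$) from $\Gamma, \Diamond\Gamma, \Diamond\overline{A}, A$ infer $\Diamond\Gamma, \Box A, \Delta$. The sequent calculus $\mathsf{K4_{Seq}}$ is obtained from $\mathsf{GL_{Seq}}$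 by replacing the rule $\Box_{\mathsf{GL}}$ by the rule - ($\Box$) from $\Gamma, \Diamond\Gamma, A$ infer $\Diamond\Gamma, \Box A, \Delta$. A derivation is a finite tree whose nodes are marked by sequents and which is constructed according to the rules of the calculus (the root is the derived sequent, the children of an interior node are the premises of a rule instance whose conclusion is that node). An $\infty$-derivation is defined in the same way except that the tree may be infinite (non-well-founded). An ($\infty$-)proof is an ($\infty$-)derivation in which all leaves are marked by initial sequents. (No further condition is imposed on infinite branches.) A circular derivation is a pair $(\kappa, d)$, where $\kappa$ is an ordinary (finite) derivation and $d$ is a back-link function assigning to some leaves $x$ an interior node $y$ marked by an identical sequent such that $y$ lies on the path from the root to $x$. A circular proof is a circular derivation such that every leaf is either in the domain of the back-link function or marked by an initial sequent. $\mathsf{GL_{Seq}} \vdash \Gamma$ means that there is an ordinary (finite) proof of $\Gamma$ in $\mathsf{GL_{Seq}}$. $\mathsf{GL_{\infty}} \vdash \Gamma$ means that there is an $\infty$-proof with root $\Gamma$ using the initial sequents and rules of $\mathsf{K4_{Seq}}$. $\mathsf{GL_{circ}} \vdash \Gamma$ means that there is a circular proof with root $\Gamma$ using the initial sequents and rules of $\mathsf{K4_{Seq}}$. *)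

theory Defs
  imports "HOL-Library.Multiset" "HOL-Library.Sublist"
begin

datatype 'a fm =
    Atom 'a
  | CoAtom 'a
  | Top
  | Bot
  | And "'a fm" "'a fm"
  | Or "'a fm" "'a fm"
  | Box "'a fm"
  | Dia "'a fm"

primrec neg :: "'a fm \<Rightarrow> 'a fm" where
  "neg (Atom P) = CoAtom P"
| "neg (CoAtom P) = Atom P"
| "neg Top = Bot"
| "neg Bot = Top"
| "neg (And A B) = Or (neg A) (neg B)"
| "neg (Or A B) = And (neg A) (neg B)"
| "neg (Box A) = Dia (neg A)"
| "neg (Dia A) = Box (neg A)"

type_synonym 'a sequent = "'a fm multiset"

abbreviation Dias :: "'a sequent \<Rightarrow> 'a sequent" where
  "Dias \<Gamma> \<equiv> image_mset Dia \<Gamma>"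

inductive initial :: "'a sequent \<Rightarrow> bool" where
  initial_ax: "initial (\<Gamma> + {#A, neg A#})"
| initial_top: "initial (\<Gamma> + {#Top#})"

text \<open>A set of inference rules is a relation between the list of premises and the conclusion.
  Every rule below has at least one premise; initial sequents are not counted as rules.\<close>

type_synonym 'a rules = "'a sequent list \<Rightarrow> 'a sequent \<Rightarrow> bool"

inductive GL_rules :: "'a rules" where
  GL_and: "GL_rules [\<Gamma> + {#A#}, \<Gamma> + {#B#}] (\<Gamma> + {#And A B#})"
| GL_or: "GL_rules [\<Gamma> + {#A, B#}] (\<Gamma> + {#Or A B#})"
| GL_box: "GL_rules [\<Gamma> + Dias \<Gamma> + {#Dia (neg A), A#}] (Dias \<Gamma> + {#Box A#} + \<Delta>)"

inductive K4_rules :: "'a rules" where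
  K4_and: "K4_rules [\<Gamma> + {#A#}, \<Gamma> + {#B#}] (\<Gamma> + {#And A B#})"
| K4_or: "K4_rules [\<Gamma> + {#A, B#}] (\<Gamma> + {#Or A B#})"
| K4_box: "K4_rules [\<Gamma> + Dias \<Gamma> + {#A#}] (Dias \<Gamma> + {#Box A#} + \<Delta>)"

text \<open>Trees are finitely branching, but may have infinite branches.  A node is addressed by the
  list of child indices on the path leading to it from the root, so that the nodes on the path
  from the root to \<open>x\<close> are the prefixes of \<open>x\<close>.\<close>

codatatype 'a dtree = Node (label: "'a sequent") (children: "'a dtree list")

primrec subtree_at :: "nat list \<Rightarrow> 'a dtree \<Rightarrow> 'a dtree option" where
  "subtree_at [] t = Some t"
| "subtree_at (i # p) t =
     (if i < length (children t) then subtree_at p (children t ! i) else None)"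

definition nodes :: "'a dtree \<Rightarrow> nat list set" where
  "nodes t = {p. subtree_at p t \<noteq> None}"

definition label_at :: "'a dtree \<Rightarrow> nat list \<Rightarrow> 'a sequent" where
  "label_at t p = label (the (subtree_at p t))"

definition children_at :: "'a dtree \<Rightarrow> nat list \<Rightarrow> 'a dtree list" where
  "children_at t p = children (the (subtree_at p t))"

definition leaves :: "'a dtree \<Rightarrow> nat list set" where
  "leaves t = {p \<in> nodes t. children_at t p = []}"

definition interior_nodes :: "'a dtree \<Rightarrow> nat list set" where
  "interior_nodes t = nodes t - leaves t"

text \<open>Leaves of derivations are unrestricted; only proofs require them to be initial.\<close>

definition inf_derivation :: "'a rules \<Rightarrow> 'a dtree \<Rightarrow> bool" where
  "inf_derivation R t \<longleftrightarrow>
     (\<forall>p \<in> interior_nodes t. R (map label (children_at t p)) (label_at t p))"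

definition derivation :: "'a rules \<Rightarrow> 'a dtree \<Rightarrow> bool" where
  "derivation R t \<longleftrightarrow> inf_derivation R t \<and> finite (nodes t)"

definition inf_proof :: "'a rules \<Rightarrow> 'a dtree \<Rightarrow> bool" where
  "inf_proof R t \<longleftrightarrow> inf_derivation R t \<and> (\<forall>x \<in> leaves t. initial (label_at t x))"

definition ordinary_proof :: "'a rules \<Rightarrow> 'a dtree \<Rightarrow> bool" where
  "ordinary_proof R t \<longleftrightarrow> derivation R t \<and> (\<forall>x \<in> leaves t. initial (label_at t x))"

definition circular_derivation ::
    "'a rules \<Rightarrow> 'a dtree \<times> (nat list \<rightharpoonup> nat list) \<Rightarrow> bool" where
  "circular_derivation R = (\<lambda>(\<kappa>, d). derivation R \<kappa> \<and> dom d \<subseteq> leaves \<kappa> \<and>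
     (\<forall>x y. d x = Some y \<longrightarrow>
        y \<in> interior_nodes \<kappa> \<and> prefix y x \<and> label_at \<kappa> y = label_at \<kappa> x))"

definition circular_proof ::
    "'a rules \<Rightarrow> 'a dtree \<times> (nat list \<rightharpoonup> nat list) \<Rightarrow> bool" where
  "circular_proof R = (\<lambda>(\<kappa>, d). circular_derivation R (\<kappa>, d) \<and>
     (\<forall>x \<in> leaves \<kappa>. x \<in> dom d \<or> initial (label_at \<kappa> x)))"

definition GL_Seq :: "'a sequent \<Rightarrow> bool" where
  "GL_Seq \<Gamma> \<longleftrightarrow> (\<exists>t. ordinary_proof GL_rules t \<and> label t = \<Gamma>)"

definition GL_inf :: "'a sequent \<Rightarrow> bool" where
  "GL_inf \<Gamma> \<longleftrightarrow> (\<exists>t. inf_proof K4_rules t \<and> label t = \<Gamma>)"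

definition GL_circ :: "'a sequent \<Rightarrow> bool" where
  "GL_circ \<Gamma> \<longleftrightarrow> (\<exists>\<kappa> d. circular_proof K4_rules (\<kappa>, d) \<and> label \<kappa> = \<Gamma>)"

end

(* All three calculi derive exactly the sequents valid in finite transitive conversely well-founded
   models. Soundness holds for arbitrary infinite proofs: from a falsified conclusion one moves to a
   falsified premise, and this either stays at the same world with a smaller sequent or moves to a
   later world, which is impossible forever. For completeness, backward proof search either succeeds
   or yields a countermodel. In GL it terminates because a box formula unfolded twice on a branch
   gives an initial sequent; in K4 the premises of box steps range over a finite set, and a
   repetition becomes a back-link. Circular proofs unfold to infinite ones. *)

theory Submission
  imports Defs
begin

section \<open>Sequents and their models\<close>

lemma neg_neg [simp]: "neg (neg A) = A"
  by (induction A) auto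

lemma neg_neq: "neg A \<noteq> A"
  by (cases A) auto

lemma initial_negI:
  assumes "A \<in># \<Gamma>" "neg A \<in># \<Gamma>"
  shows "initial \<Gamma>"
proof -
  obtain \<Gamma>' where \<Gamma>': "\<Gamma> = add_mset A \<Gamma>'"
    using assms(1) by (metis mset_add)
  \<comment> \<open>\<open>A\<close> and \<open>neg A\<close> are distinct formulas, so removing one
    \<open>A\<close> leaves the occurrence of \<open>neg A\<close> in place.\<close>
  with assms(2) neg_neq[of A] have "neg A \<in># \<Gamma>'"
    by auto
  then obtain \<Gamma>'' where "\<Gamma>' = add_mset (neg A) \<Gamma>''"
    by (metis mset_add)
  with \<Gamma>' have "\<Gamma> = \<Gamma>'' + {#A, neg A#}"
    by (simp add: add_mset_commute)
  then show ?thesis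
    by (simp only: initial_ax)
qed

lemma initial_TopI:
  assumes "Top \<in># \<Gamma>"
  shows "initial \<Gamma>"
proof -
  obtain \<Gamma>' where "\<Gamma> = \<Gamma>' + {#Top#}"
    using assms by (metis add_mset_add_single mset_add)
  then show ?thesis
    by (simp only: initial_top)
qed

text \<open>A model is a finite tree of worlds; accessibility is the proper descendant relation, which is
  transitive and conversely well-founded.\<close>

datatype 'a model = World "'a set" "'a model list"

primrec desc :: "'a model \<Rightarrow> 'a model set" where
  "desc (World V ts) = \<Union> (set (map (\<lambda>t. insert t (desc t)) ts))"

lemma desc_World: "s \<in> desc (World V ts) \<longleftrightarrow> (\<exists>t \<in> set ts. s = t \<or> s \<in> desc t)"
  by auto

declare desc.simps [simp del]

text \<open>This strict decrease is the converse well-foundedness of accessibility.\<close>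

lemma desc_size: "s \<in> desc t \<Longrightarrow> size s < size t"
proof (induction t)
  case (World V ts)
  then obtain t where t: "t \<in> set ts" and "s = t \<or> s \<in> desc t"
    by (auto simp: desc_World)
  with World.IH have "size s \<le> size t"
    by (auto intro: less_imp_le)
  moreover have "size t < size (World V ts)"
    using size_list_estimation'[OF t order_refl, of size] by simp
  ultimately show ?case
    by simp
qed

lemma desc_trans: "u \<in> desc s \<Longrightarrow> s \<in> desc t \<Longrightarrow> u \<in> desc t"
  by (induction t) (auto simp: desc_World)

text \<open>Evaluation is at the root. Truth depends on the tree alone, so models can be grafted
  below a new root without changing what they force.\<close>

primrec forces :: "'a fm \<Rightarrow> 'a model \<Rightarrow> bool" where
  "forces (Atom P) t \<longleftrightarrow> (case t of World V ts \<Rightarrow> P \<in> V)"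
| "forces (CoAtom P) t \<longleftrightarrow> (case t of World V ts \<Rightarrow> P \<notin> V)"
| "forces Top t \<longleftrightarrow> True"
| "forces Bot t \<longleftrightarrow> False"
| "forces (And A B) t \<longleftrightarrow> forces A t \<and> forces B t"
| "forces (Or A B) t \<longleftrightarrow> forces A t \<or> forces B t"
| "forces (Box A) t \<longleftrightarrow> (\<forall>s \<in> desc t. forces A s)"
| "forces (Dia A) t \<longleftrightarrow> (\<exists>s \<in> desc t. forces A s)"

lemma forces_neg [simp]: "forces (neg A) t \<longleftrightarrow> \<not> forces A t"
  by (induction A arbitrary: t) (auto split: model.split)

definition falsifies :: "'a model \<Rightarrow> 'a sequent \<Rightarrow> bool" where
  "falsifies t \<Gamma> \<longleftrightarrow> (\<forall>A \<in># \<Gamma>. \<not> forces A t)"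

abbreviation valid :: "'a sequent \<Rightarrow> bool" where
  "valid \<Gamma> \<equiv> \<forall>t. \<not> falsifies t \<Gamma>"

lemma initial_valid: "initial \<Gamma> \<Longrightarrow> valid \<Gamma>"
  by (induction rule: initial.induct) (auto simp: falsifies_def)

lemma falsifies_add_mset [simp]:
  "falsifies t (add_mset A \<Gamma>) \<longleftrightarrow> \<not> forces A t \<and> falsifies t \<Gamma>"
  by (simp add: falsifies_def)

lemma falsifies_empty [simp]: "falsifies t {#}"
  by (simp add: falsifies_def)

lemma falsifies_union [simp]:
  "falsifies t (\<Gamma> + \<Delta>) \<longleftrightarrow> falsifies t \<Gamma> \<and> falsifies t \<Delta>"
  by (auto simp: falsifies_def)

text \<open>The second part is transitivity: a world seen from \<open>s\<close> is already seen from
  \<open>t\<close>.\<close>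

lemma falsifies_Dias:
  assumes "falsifies t (Dias \<Gamma>)" "s \<in> desc t"
  shows "falsifies s \<Gamma>" "falsifies s (Dias \<Gamma>)"
  using assms desc_trans[OF _ assms(2)] by (fastforce simp: falsifies_def)+

section \<open>Soundness\<close>

definition complexity :: "'a sequent \<Rightarrow> nat" where
  "complexity \<Gamma> = (\<Sum>A \<in># \<Gamma>. size A)"

text \<open>Stated as progress of a falsification from conclusion to premise, not as preservation of
  validity, so that it also controls infinite branches.\<close>

definition locally_sound :: "'a rules \<Rightarrow> bool" where
  "locally_sound R \<longleftrightarrow> (\<forall>\<Gamma>s \<Gamma> t. R \<Gamma>s \<Gamma> \<longrightarrow> falsifies t \<Gamma> \<longrightarrow>
     (\<exists>\<Delta> \<in> set \<Gamma>s. \<exists>s. falsifies s \<Delta> \<and>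
        (s \<in> desc t \<or> s = t \<and> complexity \<Delta> < complexity \<Gamma>)))"

lemma locally_sound_K4: "locally_sound K4_rules"
  unfolding locally_sound_def
proof (intro allI impI)
  fix \<Gamma>s and \<Gamma> :: "'a sequent" and t
  assume "K4_rules \<Gamma>s \<Gamma>" "falsifies t \<Gamma>"
  then show "\<exists>\<Delta> \<in> set \<Gamma>s. \<exists>s. falsifies s \<Delta> \<and>
      (s \<in> desc t \<or> s = t \<and> complexity \<Delta> < complexity \<Gamma>)"
  proof cases
    case (K4_box \<Gamma>' A \<Delta>)
    with \<open>falsifies t \<Gamma>\<close> obtain s where "s \<in> desc t" "\<not> forces A s"
      by (auto simp: falsifies_def)
    moreover from this(1) have "falsifies s (\<Gamma>' + Dias \<Gamma>' + {#A#})"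
      using K4_box \<open>falsifies t \<Gamma>\<close> \<open>\<not> forces A s\<close>
      by (auto simp: falsifies_Dias[of t \<Gamma>' s])
    ultimately show ?thesis
      using K4_box by auto
  qed (auto simp: falsifies_def complexity_def)
qed

text \<open>The premise also contains \<open>Dia (neg A)\<close>, which must fail as well, so the
  box case picks a refuting descendant of least size. This is Loeb's argument.\<close>

lemma locally_sound_GL: "locally_sound GL_rules"
  unfolding locally_sound_def
proof (intro allI impI)
  fix \<Gamma>s and \<Gamma> :: "'a sequent" and t
  assume "GL_rules \<Gamma>s \<Gamma>" "falsifies t \<Gamma>"
  then show "\<exists>\<Delta> \<in> set \<Gamma>s. \<exists>s. falsifies s \<Delta> \<and>
      (s \<in> desc t \<or> s = t \<and> complexity \<Delta> < complexity \<Gamma>)"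
  proof cases
    case (GL_box \<Gamma>' A \<Delta>)
    with \<open>falsifies t \<Gamma>\<close> have ex: "\<exists>s. s \<in> desc t \<and> \<not> forces A s"
      by (auto simp: falsifies_def)
    txt \<open>Minimality makes every descendant force \<open>A\<close>, which falsifies \<open>Dia (neg A)\<close>.\<close>
    obtain s where s: "s \<in> desc t" "\<not> forces A s"
      and min: "\<And>u. u \<in> desc t \<and> \<not> forces A u \<Longrightarrow> size s \<le> size u"
      using exists_least_iff[of "\<lambda>n. \<exists>s. (s \<in> desc t \<and> \<not> forces A s) \<and> size s = n"] ex
      by (metis linorder_not_le)
    have "forces A u" if "u \<in> desc s" for u
      using min[of u] desc_size[OF that] desc_trans[OF that s(1)] by auto
    then have "falsifies s (\<Gamma>' + Dias \<Gamma>' + {#Dia (neg A), A#})"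
      using GL_box \<open>falsifies t \<Gamma>\<close> s
      by (auto simp: falsifies_Dias[of t \<Gamma>' s])
    with s(1) show ?thesis
      using GL_box by auto
  qed (auto simp: falsifies_def complexity_def)
qed

text \<open>What infinite and circular proofs have in common: the set of their labels, with the tree
  shape forgotten and cycles allowed.\<close>

definition backward_closed :: "'a rules \<Rightarrow> 'a sequent set \<Rightarrow> bool" where
  "backward_closed R X \<longleftrightarrow> (\<forall>\<Gamma> \<in> X. initial \<Gamma> \<or> (\<exists>\<Gamma>s. R \<Gamma>s \<Gamma> \<and> set \<Gamma>s \<subseteq> X))"

text \<open>The descent is along the model, not along a derivation: each move to a falsified premise
  lowers the pair of world size and complexity lexicographically.\<close>

lemma backward_closed_valid:
  assumes R: "locally_sound R" and X: "backward_closed R X" and "\<Gamma> \<in> X"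
  shows "valid \<Gamma>"
proof -
  have "\<Gamma> \<in> X \<Longrightarrow> \<not> falsifies t \<Gamma>" for t \<Gamma>
  proof (induction "(t, \<Gamma>)" arbitrary: t \<Gamma>
      rule: wf_induct_rule[OF wf_measures[of "[\<lambda>(t, \<Gamma>). size t, \<lambda>(t, \<Gamma>). complexity \<Gamma>]"]])
    case (1 t \<Gamma>)
    show ?case
    proof
      assume f: "falsifies t \<Gamma>"
      then have "\<not> initial \<Gamma>"
        using initial_valid by blast
      then obtain \<Gamma>s where "R \<Gamma>s \<Gamma>" and sub: "set \<Gamma>s \<subseteq> X"
        using X \<open>\<Gamma> \<in> X\<close> by (auto simp: backward_closed_def)
      then obtain \<Delta> s where "\<Delta> \<in> set \<Gamma>s" "falsifies s \<Delta>"
        "s \<in> desc t \<or> s = t \<and> complexity \<Delta> < complexity \<Gamma>"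
        using R f unfolding locally_sound_def by blast
      with 1(1)[of s \<Delta>] sub show False
        by (auto dest: desc_size)
    qed
  qed
  with \<open>\<Gamma> \<in> X\<close> show ?thesis
    by blast
qed

section \<open>Derivation trees\<close>

lemma label_at_Nil [simp]: "label_at t [] = label t"
  by (simp add: label_at_def)

lemma label_at_Node_Cons [simp]:
  "i < length ts \<Longrightarrow> label_at (Node \<Gamma> ts) (i # p) = label_at (ts ! i) p"
  by (simp add: label_at_def)

lemma children_at_Nil [simp]: "children_at t [] = children t"
  by (simp add: children_at_def)

lemma children_at_Node_Cons [simp]:
  "i < length ts \<Longrightarrow> children_at (Node \<Gamma> ts) (i # p) = children_at (ts ! i) p"
  by (simp add: children_at_def)

lemma Nil_in_nodes [simp]: "[] \<in> nodes t"
  by (simp add: nodes_def)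

lemma Cons_in_nodes_Node [simp]:
  "i # p \<in> nodes (Node \<Gamma> ts) \<longleftrightarrow> i < length ts \<and> p \<in> nodes (ts ! i)"
  by (simp add: nodes_def)

lemma nodes_Node:
  "nodes (Node \<Gamma> ts) = insert [] (\<Union>i < length ts. (#) i ` nodes (ts ! i))"
proof -
  have "p \<in> nodes (Node \<Gamma> ts) \<longleftrightarrow> p \<in> insert [] (\<Union>i < length ts. (#) i ` nodes (ts ! i))" for p
    by (cases p) auto
  then show ?thesis
    by blast
qed

lemma leaves_iff: "p \<in> leaves t \<longleftrightarrow> p \<in> nodes t \<and> children_at t p = []"
  by (simp add: leaves_def)

lemma interior_iff: "p \<in> interior_nodes t \<longleftrightarrow> p \<in> nodes t \<and> children_at t p \<noteq> []"
  by (auto simp: interior_nodes_def leaves_def)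

lemma derivation_leaf: "derivation R (Node \<Gamma> [])"
  by (auto simp: derivation_def inf_derivation_def interior_iff nodes_Node)

lemma derivation_Node:
  assumes "R (map label ts) \<Gamma>" and ts: "\<And>t. t \<in> set ts \<Longrightarrow> derivation R t"
  shows "derivation R (Node \<Gamma> ts)"
  unfolding derivation_def inf_derivation_def
proof (intro conjI ballI)
  fix p assume "p \<in> interior_nodes (Node \<Gamma> ts)"
  with assms show "R (map label (children_at (Node \<Gamma> ts) p)) (label_at (Node \<Gamma> ts) p)"
    by (cases p) (auto simp: interior_iff derivation_def inf_derivation_def)
next
  show "finite (nodes (Node \<Gamma> ts))"
    using ts by (auto simp: nodes_Node derivation_def)
qed

lemma subtree_at_append:
  "subtree_at (p @ q) t = (case subtree_at p t of None \<Rightarrow> None | Some s \<Rightarrow> subtree_at q s)"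
  by (induction p arbitrary: t) auto

text \<open>A proper prefix of a leaf has a child on the way to it. Back-link targets can therefore
  be chosen merely as proper prefixes with the right label.\<close>

lemma strict_prefix_leaf_interior:
  assumes "x \<in> leaves t" "strict_prefix y x"
  shows "y \<in> interior_nodes t"
proof -
  obtain i q where "x = y @ i # q"
    using assms(2) by (metis strict_prefix_def prefixE append_Nil2 neq_Nil_conv)
  with assms(1) show ?thesis
    by (auto simp: leaves_def nodes_def interior_iff children_at_def subtree_at_append
        split: option.splits if_splits)
qed

lemma child_in_nodes:
  assumes "p \<in> nodes t" "s \<in> set (children_at t p)"
  shows "\<exists>q \<in> nodes t. label s = label_at t q"
proof -
  obtain u where u: "subtree_at p t = Some u"
    using assms(1) by (auto simp: nodes_def)
  with assms(2) obtain i where i: "i < length (children u)" "s = children u ! i"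
    by (auto simp: children_at_def in_set_conv_nth)
  with u have "subtree_at (p @ [i]) t = Some s"
    by (simp add: subtree_at_append)
  then show ?thesis
    by (intro bexI[of _ "p @ [i]"]) (auto simp: nodes_def label_at_def)
qed

lemma interior_premises:
  assumes "inf_derivation R t" "p \<in> interior_nodes t"
  shows "\<exists>\<Gamma>s. R \<Gamma>s (label_at t p) \<and> set \<Gamma>s \<subseteq> label_at t ` nodes t"
  using assms child_in_nodes[of p t]
  by (fastforce simp: inf_derivation_def interior_iff)

lemma inf_proof_backward_closed:
  assumes "inf_proof R t"
  shows "backward_closed R (label_at t ` nodes t)"
proof -
  have "initial (label_at t x) \<or>
      (\<exists>\<Gamma>s. R \<Gamma>s (label_at t x) \<and> set \<Gamma>s \<subseteq> label_at t ` nodes t)" if "x \<in> nodes t" for x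
    using assms interior_premises[of R t x] that
    by (auto simp: inf_proof_def leaves_iff interior_iff)
  then show ?thesis
    by (auto simp: backward_closed_def)
qed

text \<open>A linked leaf borrows the premises of its target, which is interior and has the same
  label.\<close>

lemma circular_proof_backward_closed:
  assumes "circular_proof R (t, d)"
  shows "backward_closed R (label_at t ` nodes t)"
proof -
  have t: "inf_derivation R t"
    and d: "\<And>x y. d x = Some y \<Longrightarrow> y \<in> interior_nodes t \<and> label_at t y = label_at t x"
    and l: "\<And>x. x \<in> leaves t \<Longrightarrow> x \<in> dom d \<or> initial (label_at t x)"
    using assms by (auto simp: circular_proof_def circular_derivation_def derivation_def)
  have "initial (label_at t x) \<or>
      (\<exists>\<Gamma>s. R \<Gamma>s (label_at t x) \<and> set \<Gamma>s \<subseteq> label_at t ` nodes t)" if x: "x \<in> nodes t" for x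
  proof (cases "x \<in> leaves t \<and> \<not> initial (label_at t x)")
    case True
    then obtain y where "d x = Some y"
      using l by blast
    then show ?thesis
      using d[of x y] interior_premises[OF t, of y] by auto
  next
    case False
    with x show ?thesis
      using interior_premises[OF t, of x] by (auto simp: leaves_iff interior_iff)
  qed
  then show ?thesis
    by (auto simp: backward_closed_def)
qed

section \<open>Unfolding backward closed sets into infinite proofs\<close>

primcorec unfold_tree :: "('a sequent \<Rightarrow> 'a sequent list) \<Rightarrow> 'a sequent \<Rightarrow> 'a dtree" where
  "unfold_tree f \<Gamma> = Node \<Gamma> (map (unfold_tree f) (f \<Gamma>))"

lemma subtree_unfold_tree:
  assumes "\<And>\<Gamma>. \<Gamma> \<in> X \<Longrightarrow> set (f \<Gamma>) \<subseteq> X"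
  shows "\<Gamma> \<in> X \<Longrightarrow> subtree_at p (unfold_tree f \<Gamma>) = Some s \<Longrightarrow> \<exists>\<Delta> \<in> X. s = unfold_tree f \<Delta>"
proof (induction p arbitrary: \<Gamma>)
  case (Cons i p)
  then have i: "i < length (f \<Gamma>)" and "subtree_at p (unfold_tree f (f \<Gamma> ! i)) = Some s"
    by (auto split: if_splits)
  moreover have "f \<Gamma> ! i \<in> X"
    using assms[OF Cons.prems(1)] nth_mem[OF i] by blast
  ultimately show ?case
    using Cons.IH by blast
qed auto

text \<open>One choice of premises per sequent generates the whole tree; cycles in \<open>X\<close>
  become infinite branches.\<close>

lemma backward_closed_inf_proof:
  fixes \<Gamma> :: "'a sequent"
  assumes R: "\<And>\<Delta>. \<not> R [] \<Delta>" and X: "backward_closed R X" and "\<Gamma> \<in> X"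
  shows "\<exists>t. inf_proof R t \<and> label t = \<Gamma>"
proof -
  \<comment> \<open>The empty list turns an initial sequent into a leaf. Any other sequent gets the
    premises of a rule, a nonempty list, so no further leaves arise.\<close>
  have "\<forall>\<Gamma> \<in> X. \<exists>\<Gamma>s. set \<Gamma>s \<subseteq> X \<and> (if initial \<Gamma> then \<Gamma>s = [] else R \<Gamma>s \<Gamma>)"
    using X unfolding backward_closed_def by (metis empty_set empty_subsetI)
  then obtain f where f: "\<And>\<Gamma>. \<Gamma> \<in> X \<Longrightarrow> set (f \<Gamma>) \<subseteq> X"
    "\<And>\<Gamma>. \<Gamma> \<in> X \<Longrightarrow> if initial \<Gamma> then f \<Gamma> = [] else R (f \<Gamma>) \<Gamma>"
    by metis
  let ?t = "unfold_tree f \<Gamma>"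
  have at: "\<exists>\<Delta> \<in> X. label_at ?t p = \<Delta> \<and> children_at ?t p = map (unfold_tree f) (f \<Delta>)"
    if "p \<in> nodes ?t" for p
    using that subtree_unfold_tree[OF f(1) \<open>\<Gamma> \<in> X\<close>, where p = p]
    by (fastforce simp: nodes_def label_at_def children_at_def)
  have lab: "map label (map (unfold_tree f) \<Gamma>s) = \<Gamma>s" for \<Gamma>s :: "'a sequent list"
    by (simp add: comp_def)
  have "inf_proof R ?t"
    unfolding inf_proof_def inf_derivation_def
  proof (intro conjI ballI)
    fix p assume "p \<in> interior_nodes ?t"
    then have p: "p \<in> nodes ?t" "children_at ?t p \<noteq> []"
      by (auto simp: interior_iff)
    with at[OF p(1)] f(2) show "R (map label (children_at ?t p)) (label_at ?t p)"
      by (force simp: lab simp del: map_map split: if_splits)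
  next
    fix p assume "p \<in> leaves ?t"
    then have p: "p \<in> nodes ?t" "children_at ?t p = []"
      by (auto simp: leaves_iff)
    with at[OF p(1)] obtain \<Delta> where \<Delta>: "\<Delta> \<in> X" "label_at ?t p = \<Delta>" "f \<Delta> = []"
      by auto
    with f(2)[of \<Delta>] R show "initial (label_at ?t p)"
      by (auto split: if_splits)
  qed
  then show ?thesis
    by (intro exI[of _ ?t]) simp
qed

lemma K4_rules_nonempty: "\<not> K4_rules [] \<Gamma>"
  by (auto elim: K4_rules.cases)

section \<open>Finite derivability with and without back-links\<close>

inductive derivable :: "'a rules \<Rightarrow> 'a sequent \<Rightarrow> bool" for R where
  derivable_initial: "initial \<Gamma> \<Longrightarrow> derivable R \<Gamma>"
| derivable_rule: "R \<Gamma>s \<Gamma> \<Longrightarrow> \<forall>\<Delta> \<in> set \<Gamma>s. derivable R \<Delta> \<Longrightarrow> derivable R \<Gamma>"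

text \<open>The history \<open>H\<close> contains the labels of the targets that back-links may reach below the current
  node. Recording a premise only when moving to it keeps a node from being linked to itself.\<close>

inductive circ_derivable :: "'a rules \<Rightarrow> 'a sequent set \<Rightarrow> 'a sequent \<Rightarrow> bool" for R where
  circ_initial: "initial \<Gamma> \<Longrightarrow> circ_derivable R H \<Gamma>"
| circ_rule: "R \<Gamma>s \<Gamma> \<Longrightarrow> \<forall>\<Delta> \<in> set \<Gamma>s. \<Delta> \<in> H \<or> circ_derivable R (insert \<Delta> H) \<Delta>
    \<Longrightarrow> circ_derivable R H \<Gamma>"

lemma circ_derivable_mono: "circ_derivable R H \<Gamma> \<Longrightarrow> H \<subseteq> H' \<Longrightarrow> circ_derivable R H' \<Gamma>"
proof (induction arbitrary: H' rule: circ_derivable.induct)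
  case (circ_rule \<Gamma>s \<Gamma> H)
  have "\<Delta> \<in> H' \<or> circ_derivable R (insert \<Delta> H') \<Delta>" if "\<Delta> \<in> set \<Gamma>s" for \<Delta>
    using circ_rule.IH circ_rule.prems that by (metis insert_mono subsetD)
  then show ?case
    by (intro circ_derivable.circ_rule[of R \<Gamma>s]) (use circ_rule.hyps in blast)+
qed (rule circ_derivable.circ_initial)

text \<open>A larger history only permits more back-links, so a rule can also be applied without
  recording its premises.\<close>

lemma circ_derivable_rule:
  assumes "R \<Gamma>s \<Gamma>" "\<And>\<Delta>. \<Delta> \<in> set \<Gamma>s \<Longrightarrow> circ_derivable R H \<Delta>"
  shows "circ_derivable R H \<Gamma>"
  using assms by (blast intro: circ_rule circ_derivable_mono[of R H])

lemma map_label_choice: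
  assumes "\<And>\<Delta>. \<Delta> \<in> set \<Gamma>s \<Longrightarrow> \<exists>t. label t = \<Delta> \<and> Q t"
  shows "\<exists>ts. map label ts = \<Gamma>s \<and> (\<forall>t \<in> set ts. Q t)"
proof -
  obtain g where "\<And>\<Delta>. \<Delta> \<in> set \<Gamma>s \<Longrightarrow> label (g \<Delta>) = \<Delta> \<and> Q (g \<Delta>)"
    using assms by metis
  then show ?thesis
    by (intro exI[of _ "map g \<Gamma>s"]) (auto simp: map_idI)
qed

lemma derivable_ordinary_proof:
  assumes R: "\<And>\<Delta>. \<not> R [] \<Delta>"
  shows "derivable R \<Gamma> \<Longrightarrow> \<exists>t. label t = \<Gamma> \<and> ordinary_proof R t"
proof (induction rule: derivable.induct)
  case (derivable_initial \<Gamma>)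
  then show ?case
    by (intro exI[of _ "Node \<Gamma> []"])
      (auto simp: ordinary_proof_def derivation_leaf leaves_iff nodes_Node)
next
  case (derivable_rule \<Gamma>s \<Gamma>)
  then obtain ts where ts: "map label ts = \<Gamma>s" "\<forall>t \<in> set ts. ordinary_proof R t"
    using map_label_choice[of \<Gamma>s "ordinary_proof R"] by blast
  \<comment> \<open>Otherwise the root would be a leaf and would have to be initial.\<close>
  have "ts \<noteq> []"
    using ts(1) R derivable_rule.hyps by auto
  then have "ordinary_proof R (Node \<Gamma> ts)"
    using ts derivable_rule.hyps
    by (auto simp: ordinary_proof_def leaves_iff nodes_Node intro!: derivation_Node)
  then show ?case
    by (intro exI[of _ "Node \<Gamma> ts"]) simp
qed

text \<open>\<open>H\<close> stands for targets that are not proper prefixes inside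
  \<open>t\<close>. Since it may contain the label of the root of \<open>t\<close>, the condition
  \<open>x \<noteq> []\<close> prevents a one-node tree from discharging itself.\<close>

definition linked_leaf :: "'a sequent set \<Rightarrow> 'a dtree \<Rightarrow> nat list \<Rightarrow> bool" where
  "linked_leaf H t x \<longleftrightarrow> initial (label_at t x) \<or> x \<noteq> [] \<and> label_at t x \<in> H \<or>
     (\<exists>y. strict_prefix y x \<and> label_at t y = label_at t x)"

lemma circ_derivable_tree:
  assumes R: "\<And>\<Delta>. \<not> R [] \<Delta>"
  shows "circ_derivable R H \<Gamma> \<Longrightarrow>
    \<exists>t. label t = \<Gamma> \<and> derivation R t \<and> (\<forall>x \<in> leaves t. linked_leaf H t x)"
proof (induction rule: circ_derivable.induct)
  case (circ_initial \<Gamma> H)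
  then show ?case
    by (intro exI[of _ "Node \<Gamma> []"])
      (auto simp: derivation_leaf leaves_iff nodes_Node linked_leaf_def)
next
  case (circ_rule \<Gamma>s \<Gamma> H)
  \<comment> \<open>The first alternative covers a premise already in \<open>H\<close>, which
    becomes a single leaf to be linked from outside.\<close>
  let ?Q = "\<lambda>t. derivation R t \<and>
    (\<forall>x \<in> leaves t. x = [] \<and> label t \<in> H \<or> linked_leaf (insert (label t) H) t x)"
  have "\<exists>t. label t = \<Delta> \<and> ?Q t" if "\<Delta> \<in> set \<Gamma>s" for \<Delta>
  proof (cases "\<Delta> \<in> H")
    case True
    then show ?thesis
      by (intro exI[of _ "Node \<Delta> []"]) (auto simp: derivation_leaf leaves_iff nodes_Node)
  next
    case False
    with circ_rule.IH that obtain t where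
      "label t = \<Delta>" "derivation R t" "\<forall>x \<in> leaves t. linked_leaf (insert \<Delta> H) t x"
      by blast
    then show ?thesis
      by (intro exI[of _ t]) auto
  qed
  from map_label_choice[of \<Gamma>s ?Q, OF this]
  obtain ts where ts: "map label ts = \<Gamma>s" "\<And>t. t \<in> set ts \<Longrightarrow> ?Q t"
    by blast
  have "ts \<noteq> []"
    using ts(1) R circ_rule.hyps by auto
  have "linked_leaf H (Node \<Gamma> ts) x" if x: "x \<in> leaves (Node \<Gamma> ts)" for x
  proof -
    obtain i p where x_eq: "x = i # p" and i: "i < length ts" and p: "p \<in> leaves (ts ! i)"
      using x \<open>ts \<noteq> []\<close> by (cases x) (auto simp: leaves_iff)
    consider "initial (label_at (ts ! i) p)" | "label_at (ts ! i) p \<in> H"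
      | "p \<noteq> []" "label_at (ts ! i) p = label_at (ts ! i) []"
      | y where "strict_prefix y p" "label_at (ts ! i) y = label_at (ts ! i) p"
      using ts(2)[OF nth_mem[OF i]] p by (auto simp: linked_leaf_def)
    then show ?thesis
    proof cases
      \<comment> \<open>The recorded premise is the root of the \<open>i\<close>-th subtree, so the
        link goes to \<open>[i]\<close>; this is a proper prefix because \<open>p\<close> is
        nonempty.\<close>
      case 3
      then show ?thesis
        using i x_eq unfolding linked_leaf_def
        by (intro disjI2 exI[of _ "[i]"]) (auto simp: strict_prefix_def)
    next
      case 4
      then show ?thesis
        using i x_eq unfolding linked_leaf_def
        by (intro disjI2 exI[of _ "i # y"]) auto
    qed (use i x_eq in \<open>auto simp: linked_leaf_def\<close>)
  qed
  moreover have "derivation R (Node \<Gamma> ts)"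
    using ts circ_rule.hyps by (auto intro!: derivation_Node)
  ultimately show ?case
    by (intro exI[of _ "Node \<Gamma> ts"]) simp
qed

lemma circ_derivable_circular_proof:
  assumes R: "\<And>\<Delta>. \<not> R [] \<Delta>" and "circ_derivable R {} \<Gamma>"
  shows "\<exists>t d. circular_proof R (t, d) \<and> label t = \<Gamma>"
proof -
  obtain t where t: "label t = \<Gamma>" "derivation R t"
    and l: "\<And>x. x \<in> leaves t \<Longrightarrow> linked_leaf {} t x"
    using circ_derivable_tree[OF assms] by blast
  \<comment> \<open>With an empty history the only alternative left for a non-initial leaf is a
    target inside the tree, so the choice is well defined.\<close>
  define d where "d x = (if x \<in> leaves t \<and> \<not> initial (label_at t x)
    then Some (SOME y. strict_prefix y x \<and> label_at t y = label_at t x) else None)" for x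
  have d: "x \<in> leaves t \<and> strict_prefix y x \<and> label_at t y = label_at t x"
    if "d x = Some y" for x y
  proof -
    have x: "x \<in> leaves t" "\<not> initial (label_at t x)"
      and y: "y = (SOME y. strict_prefix y x \<and> label_at t y = label_at t x)"
      using that by (auto simp: d_def split: if_splits)
    have "\<exists>y. strict_prefix y x \<and> label_at t y = label_at t x"
      using l[OF x(1)] x(2) by (auto simp: linked_leaf_def)
    from someI_ex[OF this] x(1) show ?thesis
      by (simp add: y)
  qed
  have "circular_derivation R (t, d)"
    using t(2) d strict_prefix_leaf_interior[of _ t]
    by (auto simp: circular_derivation_def strict_prefix_def)
  then have "circular_proof R (t, d)"
    by (auto simp: circular_proof_def d_def)
  with t(1) show ?thesis
    by blast
qed

section \<open>Completeness by proof search\<close>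

primrec parts :: "'a fm \<Rightarrow> 'a fm set" where
  "parts (Atom P) = {}"
| "parts (CoAtom P) = {}"
| "parts Top = {}"
| "parts Bot = {}"
| "parts (And A B) = {A, B}"
| "parts (Or A B) = {A, B}"
| "parts (Box A) = {A}"
| "parts (Dia A) = {A}"

lemma parts_neg: "parts (neg A) = neg ` parts A"
  by (cases A) auto

text \<open>Negations are included because the GL box rule introduces \<open>Dia (neg A)\<close>,
  which is \<open>neg (Box A)\<close>.\<close>

definition closed_set :: "'a fm set \<Rightarrow> bool" where
  "closed_set S \<longleftrightarrow> (\<forall>A \<in> S. neg A \<in> S \<and> parts A \<subseteq> S)"

lemma closed_setD:
  assumes "closed_set S" "A \<in> S"
  shows "neg A \<in> S" "parts A \<subseteq> S"
  using assms by (auto simp: closed_set_def)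

lemma closed_set_empty: "closed_set {}"
  by (simp add: closed_set_def)

lemma closed_set_union: "closed_set S \<Longrightarrow> closed_set T \<Longrightarrow> closed_set (S \<union> T)"
  by (auto simp: closed_set_def)

text \<open>Adding \<open>A\<close> and \<open>neg A\<close> suffices: the parts of
  \<open>neg A\<close> are negated parts of \<open>A\<close>, hence already in
  \<open>S\<close>.\<close>

lemma finite_closed_set_extend:
  assumes "finite S" "closed_set S" "parts A \<subseteq> S"
  shows "\<exists>T. finite T \<and> closed_set T \<and> A \<in> T"
proof -
  have "parts (neg A) \<subseteq> S"
    using assms(2,3) by (auto simp: parts_neg dest: closed_setD(1))
  then have "closed_set (insert A (insert (neg A) S))"
    using assms(2,3) by (auto simp: closed_set_def)
  with assms(1) show ?thesis
    by (intro exI[of _ "insert A (insert (neg A) S)"]) simp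
qed

lemma finite_closed_set_fm: "\<exists>S. finite S \<and> closed_set S \<and> A \<in> S"
proof (induction A)
  case (And A B)
  then obtain S T where "finite S" "closed_set S" "A \<in> S" "finite T" "closed_set T" "B \<in> T"
    by blast
  then show ?case
    by (intro finite_closed_set_extend[of "S \<union> T"]) (auto intro: closed_set_union)
next
  case (Or A B)
  then obtain S T where "finite S" "closed_set S" "A \<in> S" "finite T" "closed_set T" "B \<in> T"
    by blast
  then show ?case
    by (intro finite_closed_set_extend[of "S \<union> T"]) (auto intro: closed_set_union)
next
  case (Box A)
  then obtain S where "finite S" "closed_set S" "A \<in> S"
    by blast
  then show ?case
    by (intro finite_closed_set_extend[of S]) auto
next
  case (Dia A)
  then obtain S where "finite S" "closed_set S" "A \<in> S"
    by blast
  then show ?case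
    by (intro finite_closed_set_extend[of S]) auto
qed (auto intro: finite_closed_set_extend[OF finite.emptyI closed_set_empty])

lemma finite_closed_set: "\<exists>S. finite S \<and> closed_set S \<and> set_mset \<Gamma> \<subseteq> S"
proof (induction \<Gamma>)
  case empty
  show ?case
    by (intro exI[of _ "{}"]) (simp add: closed_set_empty)
next
  case (add A \<Gamma>)
  then obtain S where "finite S" "closed_set S" "set_mset \<Gamma> \<subseteq> S"
    by blast
  moreover obtain T where "finite T" "closed_set T" "A \<in> T"
    using finite_closed_set_fm by blast
  ultimately show ?case
    by (intro exI[of _ "S \<union> T"]) (auto intro: closed_set_union)
qed

section \<open>Saturated sequents and their countermodels\<close>

definition saturated :: "'a sequent \<Rightarrow> bool" where
  "saturated \<Gamma> \<longleftrightarrow> \<not> initial \<Gamma> \<and> (\<forall>A B. And A B \<notin># \<Gamma> \<and> Or A B \<notin># \<Gamma>)"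

definition dia_args :: "'a sequent \<Rightarrow> 'a fm set" where
  "dia_args \<Gamma> = {B. Dia B \<in># \<Gamma>}"

lemma finite_dia_args [simp]: "finite (dia_args \<Gamma>)"
proof -
  have "Dia ` dia_args \<Gamma> \<subseteq> set_mset \<Gamma>"
    by (auto simp: dia_args_def)
  then show ?thesis
    by (rule inj_on_finite[rotated]) (auto simp: inj_on_def)
qed

text \<open>Repeated diamond formulas are weakened away, so that only finitely many multisets of the
  form \<open>dia_mset \<Gamma>\<close> occur in a search.\<close>

definition dia_mset :: "'a sequent \<Rightarrow> 'a sequent" where
  "dia_mset \<Gamma> = mset_set (dia_args \<Gamma>)"

lemma in_dia_mset [simp]: "B \<in># dia_mset \<Gamma> \<longleftrightarrow> Dia B \<in># \<Gamma>"
  using finite_set_mset_mset_set[OF finite_dia_args, of \<Gamma>] by (auto simp: dia_mset_def dia_args_def)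

text \<open>Brings the sequent into the form of the conclusion of either box rule; duplicate
  diamonds and all other formulas go into the weakening part.\<close>

lemma box_decompose:
  assumes "Box A \<in># \<Gamma>"
  shows "\<exists>\<Delta>. \<Gamma> = Dias (dia_mset \<Gamma>) + {#Box A#} + \<Delta>"
proof -
  have "Dias (dia_mset \<Gamma>) = mset_set (Dia ` dia_args \<Gamma>)"
    by (simp add: dia_mset_def image_mset_mset_set inj_on_def)
  also have "\<dots> + {#Box A#} = mset_set (insert (Box A) (Dia ` dia_args \<Gamma>))"
    by (subst mset_set.insert) auto
  also have "\<dots> \<subseteq># \<Gamma>"
    using assms
    by (intro subset_mset.order_trans[OF subset_imp_msubset_mset_set mset_set_set_mset_msubset])
      (auto simp: dia_args_def)
  finally show ?thesis
    by (metis mset_subset_eq_exists_conv)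
qed

text \<open>Countermodels of the box premises are grafted below a new root. They refute all boxes,
  and since each also refutes the retained diamonds and their arguments, no diamond becomes
  true.\<close>

lemma saturated_countermodel:
  fixes \<Gamma> :: "'a sequent"
  assumes sat: "saturated \<Gamma>"
    and box: "\<And>A. Box A \<in># \<Gamma> \<Longrightarrow> \<exists>t. falsifies t (dia_mset \<Gamma> + Dias (dia_mset \<Gamma>) + {#A#})"
  shows "\<exists>t. falsifies t \<Gamma>"
proof -
  obtain g where g: "\<And>A. Box A \<in># \<Gamma> \<Longrightarrow>
      falsifies (g A) (dia_mset \<Gamma> + Dias (dia_mset \<Gamma>) + {#A#})"
    using box by metis
  have "finite {A. Box A \<in># \<Gamma>}"
    by (rule inj_on_finite[of Box _ "set_mset \<Gamma>"]) (auto simp: inj_on_def)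
  then obtain As where As: "set As = {A. Box A \<in># \<Gamma>}"
    using finite_list by blast
  \<comment> \<open>Making exactly these atoms true refutes every \<open>CoAtom P\<close>; an
    \<open>Atom P\<close> is refuted because the sequent is not initial.\<close>
  define t where "t = World {P. CoAtom P \<in># \<Gamma>} (map g As)"
  have "\<not> forces A t" if "A \<in># \<Gamma>" for A
  proof (cases A)
    case (Atom P)
    with that sat have "CoAtom P \<notin># \<Gamma>"
      by (auto simp: saturated_def dest: initial_negI)
    then show ?thesis
      by (simp add: Atom t_def)
  next
    case (Box B)
    with that have "g B \<in> desc t" "\<not> forces B (g B)"
      using g[of B] As by (auto simp: t_def desc_World)
    then show ?thesis
      by (auto simp: Box)
  next
    case (Dia B)
    then have B: "B \<in># dia_mset \<Gamma>"
      using that by simp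
    have "\<not> forces B s" if s: "s \<in> desc t" for s
    proof -
      obtain C where "Box C \<in># \<Gamma>" "s = g C \<or> s \<in> desc (g C)"
        using s As by (auto simp: t_def desc_World)
      then have "falsifies s (dia_mset \<Gamma>)"
        using g[of C] falsifies_Dias(1)[of "g C" "dia_mset \<Gamma>" s] by auto
      with B show ?thesis
        by (simp add: falsifies_def)
    qed
    then show ?thesis
      by (simp add: Dia)
  qed (use that sat in \<open>auto simp: saturated_def t_def dest: initial_TopI\<close>)
  then show ?thesis
    by (auto simp: falsifies_def)
qed

text \<open>The propositional phase of backward search. \<open>P\<close> is abstract so that one
  argument serves derivability in GL and circular derivability with a fixed history. Diamonds are
  never decomposed, so \<open>dia_args\<close> can only grow.\<close>

lemma saturation:
  assumes init: "\<And>\<Gamma>. initial \<Gamma> \<Longrightarrow> P \<Gamma>"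
    and And: "\<And>\<Gamma> A B. P (\<Gamma> + {#A#}) \<Longrightarrow> P (\<Gamma> + {#B#}) \<Longrightarrow> P (\<Gamma> + {#And A B#})"
    and Or: "\<And>\<Gamma> A B. P (\<Gamma> + {#A, B#}) \<Longrightarrow> P (\<Gamma> + {#Or A B#})"
    and S: "closed_set S"
  shows "\<not> P \<Gamma> \<Longrightarrow> set_mset \<Gamma> \<subseteq> S \<Longrightarrow> \<exists>\<Gamma>'. \<not> P \<Gamma>' \<and> saturated \<Gamma>' \<and> set_mset \<Gamma>' \<subseteq> S \<and>
    dia_args \<Gamma> \<subseteq> dia_args \<Gamma>' \<and> (\<forall>t. falsifies t \<Gamma>' \<longrightarrow> falsifies t \<Gamma>)"
proof (induction "complexity \<Gamma>" arbitrary: \<Gamma> rule: less_induct)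
  case less
  have S': "A \<in> S" "B \<in> S" if "And A B \<in> S \<or> Or A B \<in> S" for A B
    using that closed_setD(2)[OF S] by fastforce+
  have descend: ?case if "\<not> P \<Delta>" "complexity \<Delta> < complexity \<Gamma>" "set_mset \<Delta> \<subseteq> S"
    "dia_args \<Gamma> \<subseteq> dia_args \<Delta>" "\<And>t. falsifies t \<Delta> \<Longrightarrow> falsifies t \<Gamma>" for \<Delta>
    using less.hyps[OF that(2,1,3)] that(4,5) by (meson subset_trans)
  consider A B where "And A B \<in># \<Gamma>" | A B where "Or A B \<in># \<Gamma>" | "saturated \<Gamma>"
    using less.prems(1) init unfolding saturated_def by blast
  then show ?case
  proof cases
    case 1
    then obtain \<Delta> where \<Gamma>: "\<Gamma> = \<Delta> + {#And A B#}"
      by (metis add_mset_add_single mset_add)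
    then consider "\<not> P (\<Delta> + {#A#})" | "\<not> P (\<Delta> + {#B#})"
      using less.prems(1) And by blast
    then show ?thesis
    proof cases
      case 1
      then show ?thesis
        using less.prems(2) S'[of A B]
        by (intro descend[of "\<Delta> + {#A#}"]) (auto simp: \<Gamma> complexity_def dia_args_def)
    next
      case 2
      then show ?thesis
        using less.prems(2) S'[of A B]
        by (intro descend[of "\<Delta> + {#B#}"]) (auto simp: \<Gamma> complexity_def dia_args_def)
    qed
  next
    case 2
    then obtain \<Delta> where \<Gamma>: "\<Gamma> = \<Delta> + {#Or A B#}"
      by (metis add_mset_add_single mset_add)
    then have "\<not> P (\<Delta> + {#A, B#})"
      using less.prems(1) Or by blast
    then show ?thesis
      using less.prems(2) S'[of A B]
        by (intro descend[of "\<Delta> + {#A, B#}"]) (auto simp: \<Gamma> complexity_def dia_args_def)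
  next
    case 3
    with less.prems show ?thesis
      by blast
  qed
qed

section \<open>Termination of the two proof searches\<close>

lemma dia_mset_subset:
  assumes "closed_set S" "set_mset \<Gamma> \<subseteq> S"
  shows "set_mset (dia_mset \<Gamma>) \<subseteq> S" "set_mset (Dias (dia_mset \<Gamma>)) \<subseteq> S"
  using assms(2) closed_setD(2)[OF assms(1), of "Dia B" for B]
  by auto

text \<open>Each box step adds \<open>Dia (neg A)\<close>, which is never lost afterwards and makes a later \<open>Box A\<close>
  part of an initial sequent.\<close>

lemma GL_derivable_complete:
  assumes "finite S" and S: "closed_set S"
  shows "\<not> derivable GL_rules \<Gamma> \<Longrightarrow> set_mset \<Gamma> \<subseteq> S \<Longrightarrow> \<exists>t. falsifies t \<Gamma>"
\<comment> \<open>The measure bounds the box steps still possible: \<open>Dia (neg A)\<close> must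
  be absent for \<open>Box A\<close> to be unfolded.\<close>
proof (induction "card {A \<in> S. neg A \<notin> dia_args \<Gamma>}" arbitrary: \<Gamma> rule: less_induct)
  case less
  have init: "derivable GL_rules \<Gamma>" if "initial \<Gamma>" for \<Gamma> :: "'a sequent"
    using that by (rule derivable_initial)
  have And: "derivable GL_rules (\<Gamma> + {#And A B#})"
    if "derivable GL_rules (\<Gamma> + {#A#})" "derivable GL_rules (\<Gamma> + {#B#})" for \<Gamma> and A B :: "'a fm"
    using that derivable_rule[of GL_rules, OF GL_and] by auto
  have Or: "derivable GL_rules (\<Gamma> + {#Or A B#})"
    if "derivable GL_rules (\<Gamma> + {#A, B#})" for \<Gamma> and A B :: "'a fm"
    using that derivable_rule[of GL_rules, OF GL_or] by auto
  obtain \<Gamma>' where \<Gamma>': "\<not> derivable GL_rules \<Gamma>'" "saturated \<Gamma>'" "set_mset \<Gamma>' \<subseteq> S"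
    "dia_args \<Gamma> \<subseteq> dia_args \<Gamma>'" "\<And>t. falsifies t \<Gamma>' \<Longrightarrow> falsifies t \<Gamma>"
    using saturation[of "derivable GL_rules", OF init And Or S less.prems] by blast
  have "\<exists>t. falsifies t (dia_mset \<Gamma>' + Dias (dia_mset \<Gamma>') + {#A#})" if A: "Box A \<in># \<Gamma>'" for A
  proof -
    let ?D = "dia_mset \<Gamma>'" and ?Q = "dia_mset \<Gamma>' + Dias (dia_mset \<Gamma>') + {#Dia (neg A), A#}"
    obtain \<Delta> where \<Delta>: "\<Gamma>' = Dias ?D + {#Box A#} + \<Delta>"
      using box_decompose[OF A] by blast
    have nd: "\<not> derivable GL_rules ?Q"
      using \<Gamma>'(1) derivable_rule[of GL_rules, OF GL_box[of ?D A \<Delta>]] \<Delta> by auto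
    have AS: "Box A \<in> S"
      using A \<Gamma>'(3) by blast
    then have "A \<in> S" "neg (Box A) \<in> S"
      using closed_setD[OF S, of "Box A"] by auto
    then have Q: "set_mset ?Q \<subseteq> S"
      using dia_mset_subset[OF S \<Gamma>'(3)] by auto
    \<comment> \<open>\<open>Dia (neg A)\<close> is the negation of \<open>Box A\<close>, so
      together they would make the saturated sequent initial.\<close>
    have notin: "neg A \<notin> dia_args \<Gamma>'"
      using \<Gamma>'(2) A initial_negI[of "Box A" \<Gamma>'] by (auto simp: saturated_def dia_args_def)
    have "insert (neg A) (dia_args \<Gamma>') \<subseteq> dia_args ?Q"
      by (auto simp: dia_args_def)
    \<comment> \<open>\<open>A\<close> itself leaves the set, and earlier diamonds persist, so the
      inclusion is strict.\<close>
    then have "{B \<in> S. neg B \<notin> dia_args ?Q} \<subset> {B \<in> S. neg B \<notin> dia_args \<Gamma>}"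
      using notin \<Gamma>'(4) \<open>A \<in> S\<close> by blast
    then have "card {B \<in> S. neg B \<notin> dia_args ?Q} < card {B \<in> S. neg B \<notin> dia_args \<Gamma>}"
      using \<open>finite S\<close> by (auto intro: psubset_card_mono)
    from less.hyps[OF this nd Q] show ?thesis
      by auto
  qed
  with saturated_countermodel[OF \<Gamma>'(2)] \<Gamma>'(5) show ?case
    by blast
qed

text \<open>Propositional steps keep \<open>H\<close>, while a box step that no back-link can close
  adds a new element of a finite set to \<open>H\<close>.\<close>

lemma K4_circ_derivable_complete:
  assumes "finite S" and S: "closed_set S"
  shows "\<not> circ_derivable K4_rules H \<Gamma> \<Longrightarrow> set_mset \<Gamma> \<subseteq> S \<Longrightarrow> \<exists>t. falsifies t \<Gamma>"
proof -
  \<comment> \<open>All possible premises of box steps. As \<open>dia_mset\<close> has no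
    repetitions, a set \<open>D\<close> and a formula \<open>A\<close> determine the
    premise.\<close>
  define K where "K = (\<lambda>(D, A). mset_set D + Dias (mset_set D) + {#A#}) ` (Pow S \<times> S)"
  have "finite K"
    using \<open>finite S\<close> by (simp add: K_def)
  show "\<not> circ_derivable K4_rules H \<Gamma> \<Longrightarrow> set_mset \<Gamma> \<subseteq> S \<Longrightarrow> \<exists>t. falsifies t \<Gamma>"
  proof (induction "card (K - H)" arbitrary: H \<Gamma> rule: less_induct)
    case less
    have init: "circ_derivable K4_rules H \<Gamma>" if "initial \<Gamma>" for \<Gamma> :: "'a sequent"
      using that by (rule circ_initial)
    have And: "circ_derivable K4_rules H (\<Gamma> + {#And A B#})"
      if "circ_derivable K4_rules H (\<Gamma> + {#A#})" "circ_derivable K4_rules H (\<Gamma> + {#B#})"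
      for \<Gamma> and A B :: "'a fm"
      using that circ_derivable_rule[of K4_rules, OF K4_and] by auto
    have Or: "circ_derivable K4_rules H (\<Gamma> + {#Or A B#})"
      if "circ_derivable K4_rules H (\<Gamma> + {#A, B#})" for \<Gamma> and A B :: "'a fm"
      using that circ_derivable_rule[of K4_rules, OF K4_or] by auto
    obtain \<Gamma>' where \<Gamma>': "\<not> circ_derivable K4_rules H \<Gamma>'" "saturated \<Gamma>'" "set_mset \<Gamma>' \<subseteq> S"
      "\<And>t. falsifies t \<Gamma>' \<Longrightarrow> falsifies t \<Gamma>"
      using saturation[of "circ_derivable K4_rules H", OF init And Or S less.prems] by blast
    have "\<exists>t. falsifies t (dia_mset \<Gamma>' + Dias (dia_mset \<Gamma>') + {#A#})" if A: "Box A \<in># \<Gamma>'" for A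
    proof -
      let ?D = "dia_mset \<Gamma>'" and ?Q = "dia_mset \<Gamma>' + Dias (dia_mset \<Gamma>') + {#A#}"
      obtain \<Delta> where \<Delta>: "\<Gamma>' = Dias ?D + {#Box A#} + \<Delta>"
        using box_decompose[OF A] by blast
      \<comment> \<open>Otherwise \<open>circ_rule\<close> would derive \<open>\<Gamma>'\<close>, by
        a back-link in the first case and by a subproof in the second.\<close>
      have nd: "?Q \<notin> H" "\<not> circ_derivable K4_rules (insert ?Q H) ?Q"
        using \<Gamma>'(1) circ_rule[of K4_rules, OF K4_box[of ?D A \<Delta>]] \<Delta> by auto
      have "A \<in> S"
        using A \<Gamma>'(3) closed_setD(2)[OF S, of "Box A"] by auto
      then have Q: "set_mset ?Q \<subseteq> S"
        using dia_mset_subset[OF S \<Gamma>'(3)] by auto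
      have "dia_args \<Gamma>' \<subseteq> S"
        using dia_mset_subset(1)[OF S \<Gamma>'(3)]
        by (simp only: dia_mset_def finite_dia_args finite_set_mset_mset_set)
      with \<open>A \<in> S\<close> have "?Q \<in> K"
        unfolding K_def dia_mset_def by (intro image_eqI[of _ _ "(dia_args \<Gamma>', A)"]) auto
      with nd(1) have "K - insert ?Q H \<subset> K - H"
        by blast
      then have "card (K - insert ?Q H) < card (K - H)"
        using \<open>finite K\<close> by (auto intro: psubset_card_mono)
      from less.hyps[OF this nd(2) Q] show ?thesis .
    qed
    with saturated_countermodel[OF \<Gamma>'(2)] \<Gamma>'(4) show ?case
      by blast
  qed
qed

section \<open>The three calculi and validity\<close>

lemma GL_rules_nonempty: "\<not> GL_rules [] \<Gamma>"
  by (auto elim: GL_rules.cases)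

lemma GL_Seq_iff_valid: "GL_Seq \<Gamma> \<longleftrightarrow> valid \<Gamma>"
proof
  assume "GL_Seq \<Gamma>"
  then obtain t where "inf_proof GL_rules t" "label_at t [] = \<Gamma>"
    \<comment> \<open>A finite proof is in particular an infinite proof in the sense of
      \<open>inf_proof\<close>.\<close>
    by (auto simp: GL_Seq_def ordinary_proof_def inf_proof_def derivation_def)
  then show "valid \<Gamma>"
    using backward_closed_valid[OF locally_sound_GL inf_proof_backward_closed] Nil_in_nodes
    by blast
next
  assume "valid \<Gamma>"
  then have "derivable GL_rules \<Gamma>"
    using finite_closed_set[of \<Gamma>] GL_derivable_complete by blast
  then show "GL_Seq \<Gamma>"
    using derivable_ordinary_proof[of GL_rules, OF GL_rules_nonempty] by (auto simp: GL_Seq_def)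
qed

lemma GL_inf_imp_valid:
  assumes "GL_inf \<Gamma>"
  shows "valid \<Gamma>"
proof -
  obtain t where "inf_proof K4_rules t" "label_at t [] = \<Gamma>"
    using assms by (auto simp: GL_inf_def)
  then show ?thesis
    using backward_closed_valid[OF locally_sound_K4 inf_proof_backward_closed] Nil_in_nodes
    by blast
qed

lemma valid_imp_GL_circ:
  assumes "valid \<Gamma>"
  shows "GL_circ \<Gamma>"
proof -
  have "circ_derivable K4_rules {} \<Gamma>"
    using assms finite_closed_set[of \<Gamma>] K4_circ_derivable_complete by blast
  then show ?thesis
    unfolding GL_circ_def by (rule circ_derivable_circular_proof[where R = K4_rules, OF K4_rules_nonempty])
qed

lemma GL_circ_imp_GL_inf:
  assumes "GL_circ \<Gamma>"
  shows "GL_inf \<Gamma>"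
proof -
  obtain t d where "circular_proof K4_rules (t, d)" "label_at t [] = \<Gamma>"
    using assms by (auto simp: GL_circ_def)
  then have "backward_closed K4_rules (label_at t ` nodes t)" "\<Gamma> \<in> label_at t ` nodes t"
    using circular_proof_backward_closed Nil_in_nodes by blast+
  then show ?thesis
    unfolding GL_inf_def by (rule backward_closed_inf_proof[where R = K4_rules, OF K4_rules_nonempty])
qed

theorem theorem3p2:
  fixes \<Gamma> :: "'a sequent"
  shows "(GL_Seq \<Gamma> \<longleftrightarrow> GL_inf \<Gamma>) \<and> (GL_inf \<Gamma> \<longleftrightarrow> GL_circ \<Gamma>)"
  \<comment> \<open>Validity, circular and infinite provability form a cycle of implications;
    \<open>GL_Seq\<close> joins it through its equivalence with validity.\<close>
  using GL_Seq_iff_valid GL_inf_imp_valid valid_imp_GL_circ GL_circ_imp_GL_inf by blast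

end
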